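(* Let $(t_n)$ be a sequence of integers $t_n\ge 2$ with $t_n=o(\log\log n)$ as $n\to\infty$, and let $(S_n)$ be a sequence of positive integers such that, for all sufficiently large $n$, $S_n\ge N_n$ and $S_n$ is $t_n$-free. Then for all sufficiently large $n$, $\sigma(S_n)<e^\gamma S_n\log\log S_n$.
   Context: An integer $m$ is $t$-free iff $p^t\nmid m$ for every prime $p$. $\sigma$ is the sum-of-divisors function and $\gamma$ the Euler–Mascheroni constant. $p_k$ denotes the $k$-th prime and $N_k=\prod_{i=1}^k p_i$ the $k$-th primorial number. *)

theory Defs
  imports "HOL-Analysis.Analysis" "HOL-Library.Landau_Symbols" "HOL-Library.Infinite_Set"
begin

definition divisor_sigma :: "nat \<Rightarrow> nat" where
  "divisor_sigma m = (\<Sum>d\<in>{d. d dvd m}. d)"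

definition t_free :: "nat \<Rightarrow> nat \<Rightarrow> bool" where
  "t_free t m \<longleftrightarrow> (\<forall>p. prime p \<longrightarrow> \<not> p ^ t dvd m)"

text \<open>k-th prime, 1-indexed: p_1 = 2\<close>
definition nth_prime1 :: "nat \<Rightarrow> nat" where
  "nth_prime1 k = enumerate {p::nat. prime p} (k - 1)"

definition primorial :: "nat \<Rightarrow> nat" where
  "primorial k = (\<Prod>i\<in>{1..k}. nth_prime1 i)"

end

theory Submission
  imports Defs "HOL-Real_Asymp.Real_Asymp"
begin

text \<open>
  For a \<open>t\<close>-free \<open>S\<close> the quotient \<open>\<sigma>(S) / S\<close> is at most the product of \<open>1 + 1/p + \<dots> + 1/p^(t-1)\<close>
  over the primes \<open>p\<close> dividing \<open>S\<close>. Put \<open>y = ln S\<close>. At most \<open>y / ln y\<close> of these primes exceed \<open>y\<close>, and they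
  contribute a factor \<open>exp (O(1 / ln y))\<close>. Among the primes up to \<open>y\<close>, the factor of \<open>p = 2\<close> saves
  \<open>1 - 2^(-t)\<close> over the full Euler product, which by Mertens' third theorem is at most
  \<open>exp \<gamma> * ln y * exp (O(1 / ln y))\<close>. The saving wins as soon as \<open>2^t\<close> is small compared with \<open>ln y\<close>.

  For the upper bound in Mertens' third theorem, let \<open>L(x)\<close> be the logarithm of the Euler product over
  \<open>p \<le> x\<close>. Mertens' first theorem and Abel summation show that \<open>L(x) - ln (ln x)\<close> can never drop by
  more than \<open>O(1 / ln x)\<close> after \<open>x\<close>. If it exceeded \<open>\<gamma>\<close> by more than that at some \<open>x\<close>, then
  \<open>L(e^k)\<close> would exceed the harmonic number \<open>H\<^sub>k\<close> by a fixed \<open>\<eta> > 0\<close> for all large \<open>k\<close>. Weighting by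
  \<open>e^(-\<delta>k)\<close> and letting \<open>\<delta>\<close> tend to \<open>0\<close> turns this into \<open>ln \<zeta>(1 + \<delta>) \<ge> - ln (1 - e^(-\<delta>)) + \<eta> + o(1)\<close>,
  contradicting \<open>\<zeta>(1 + \<delta>) \<le> 1 + 1 / \<delta>\<close>.
\<close>

section \<open>Sums over the primes up to a bound\<close>

definition primes_upto :: "nat \<Rightarrow> nat set" where
  "primes_upto n = {p. prime p \<and> p \<le> n}"

lemma finite_primes_upto [simp]: "finite (primes_upto n)"
  unfolding primes_upto_def by (rule finite_subset[of _ "{..n}"]) auto

lemma primes_upto_Suc:
  "primes_upto (Suc n) = (if prime (Suc n) then insert (Suc n) (primes_upto n) else primes_upto n)"
  by (auto simp: primes_upto_def le_Suc_eq)

lemma Suc_notin_primes_upto [simp]: "Suc n \<notin> primes_upto n"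
  by (auto simp: primes_upto_def)

lemma sum_primes_upto_Suc:
  fixes f :: "nat \<Rightarrow> real"
  shows "sum f (primes_upto (Suc n)) = sum f (primes_upto n) + (if prime (Suc n) then f (Suc n) else 0)"
  by (simp add: primes_upto_Suc)

subsection \<open>Chebyshev's bound and Mertens' first theorem\<close>

lemma prod_primes_dvd:
  fixes n :: nat
  assumes "finite A" "\<And>p. p \<in> A \<Longrightarrow> prime p" "\<And>p. p \<in> A \<Longrightarrow> p dvd n"
  shows "\<Prod>A dvd n"
  using assms
proof (induction A rule: finite_induct)
  case (insert p A)
  have "coprime p (\<Prod>A)"
    using insert by (intro prod_coprime_right) (auto intro!: primes_coprime)
  with insert show ?case by (simp add: divides_mult)
qed simp

text \<open>The two middle coefficients of row \<open>2 * m + 1\<close> are equal, and together they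
  are at most the row sum \<open>2 * 4 ^ m\<close>.\<close>

lemma central_binomial_odd_le: "(2 * m + 1) choose m \<le> 4 ^ m"
proof -
  have "(2*m+1 choose m) + (2*m+1 choose (m+1)) = (\<Sum>k\<in>{m, m+1}. 2*m+1 choose k)" by simp
  also have "\<dots> \<le> (\<Sum>k\<le>2*m+1. 2*m+1 choose k)" by (rule sum_mono2) auto
  also have "\<dots> = 2 * 4 ^ m" by (simp only: choose_row_sum) (simp add: power_mult)
  finally show ?thesis using binomial_symmetric[of m "2*m+1"] by simp
qed

text \<open>Strong induction on \<open>n\<close>. An even \<open>n > 2\<close> is not prime and
  reduces to \<open>n - 1\<close>. For \<open>n = 2 * m + 1\<close> every prime in
  \<open>(m + 1, n]\<close> divides \<open>n choose m\<close>, so these primes contribute at most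
  \<open>m * ln 4\<close>; the primes up to \<open>m + 1\<close> contribute at most
  \<open>(m + 1) * ln 4\<close> by induction.\<close>

theorem chebyshev_theta_le: "(\<Sum>p\<in>primes_upto n. ln (real p)) \<le> real n * ln 4"
proof (induction n rule: less_induct)
  case (less n)
  consider "n \<le> 1" | "n = 2" | "n > 2" "even n" | "n > 2" "odd n" by linarith
  then show ?case
  proof cases
    case 1
    then have "primes_upto n = {}" by (auto simp: primes_upto_def dest: prime_gt_1_nat)
    then show ?thesis by simp
  next
    case 2
    then have "primes_upto 2 = {2}" by (auto simp: primes_upto_def dest: prime_gt_1_nat)
    moreover have "ln 2 \<le> ln 4 + ln (4::real)" by (intro add_increasing) auto
    ultimately show ?thesis unfolding 2 by simp
  next
    case 3
    then obtain m where m: "n = Suc m" by (cases n) auto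
    have "\<not> prime n" using 3 prime_odd_nat by auto
    then have "primes_upto n = primes_upto m" by (simp add: m primes_upto_Suc)
    moreover have "(\<Sum>p\<in>primes_upto m. ln (real p)) \<le> real m * ln 4" using less m by blast
    moreover have "real m * ln 4 \<le> real n * ln 4" using m by (intro mult_right_mono) auto
    ultimately show ?thesis by (metis order_trans)
  next
    case 4
    then obtain m where m: "n = 2 * m + 1" by (elim oddE)
    with 4 have "m \<ge> 1" by simp
    define A where "A = primes_upto n - primes_upto (m + 1)"
    have [simp]: "finite A" by (simp add: A_def)
    have pA: "prime p" "p > m + 1" "p \<le> n" if "p \<in> A" for p
      using that by (auto simp: A_def primes_upto_def)
    have "p dvd (n choose m)" if "p \<in> A" for p
    proof -
      have "fact m * fact (n - m) * (n choose m) = (fact n :: nat)"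
        by (rule binomial_fact_lemma) (use m in simp)
      then have "p dvd fact m * fact (n - m) * (n choose m)"
        using pA[OF that] by (simp add: prime_dvd_fact_iff)
      moreover have "n - m = m + 1" using m by simp
      then have "\<not> p dvd fact m" "\<not> p dvd fact (n - m)"
        using pA[OF that] by (simp_all only: prime_dvd_fact_iff)
      ultimately show ?thesis using pA[OF that] by (auto simp only: prime_dvd_mult_iff)
    qed
    then have "\<Prod>A dvd (n choose m)" using pA by (intro prod_primes_dvd) auto
    then have "\<Prod>A \<le> (n choose m)" by (rule dvd_imp_le) (use m in simp)
    also have "\<dots> \<le> 4 ^ m" unfolding m by (rule central_binomial_odd_le)
    finally have "real (\<Prod>A) \<le> real (4 ^ m)" by (simp only: of_nat_le_iff)
    moreover have "real (\<Prod>A) > 0" using pA by (simp add: prod_pos prime_gt_0_nat)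
    ultimately have "ln (real (\<Prod>A)) \<le> ln (real (4 ^ m))" by (subst ln_le_cancel_iff) auto
    also have "ln (real (\<Prod>A)) = (\<Sum>p\<in>A. ln (real p))"
      using pA by (simp add: ln_prod prime_gt_0_nat)
    finally have "(\<Sum>p\<in>A. ln (real p)) \<le> real m * ln 4" by (simp add: ln_realpow)
    moreover have "(\<Sum>p\<in>primes_upto (m+1). ln (real p)) \<le> real (m + 1) * ln 4"
      using less[of "m + 1"] m \<open>m \<ge> 1\<close> by simp
    moreover have "(\<Sum>p\<in>primes_upto n. ln (real p)) =
        (\<Sum>p\<in>A. ln (real p)) + (\<Sum>p\<in>primes_upto (m+1). ln (real p))"
      unfolding A_def by (rule sum.subset_diff) (use m in \<open>auto simp: primes_upto_def\<close>)
    ultimately show ?thesis by (simp add: m algebra_simps)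
  qed
qed

section \<open>Legendre's formula and the size of factorials\<close>

text \<open>The range of \<open>j\<close> depends only on \<open>N\<close>, so that the summations
  over \<open>m\<close> and \<open>j\<close> can be exchanged afterwards.\<close>

lemma multiplicity_eq_sum:
  fixes p m :: nat
  assumes "prime p" "m > 0" "m \<le> N"
  shows "multiplicity p m = (\<Sum>j=1..N. if p ^ j dvd m then 1 else 0)"
proof -
  have "p ^ multiplicity p m \<le> m" using assms by (intro dvd_imp_le multiplicity_dvd)
  moreover have "multiplicity p m < p ^ multiplicity p m"
    using assms by (intro power_gt_expt) (auto dest: prime_gt_1_nat)
  ultimately have le: "multiplicity p m \<le> N" using assms by linarith
  have dvd_iff: "p ^ j dvd m \<longleftrightarrow> j \<le> multiplicity p m" for j
    using assms by (intro power_dvd_iff_le_multiplicity) (auto dest: prime_gt_1_nat)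
  have "{j \<in> {1..N}. p ^ j dvd m} = {1..multiplicity p m}"
    unfolding dvd_iff using le by auto
  then show ?thesis by (simp add: sum.If_cases Int_def)
qed

lemma card_multiples_upto:
  fixes d N :: nat
  assumes "d > 0"
  shows "card {m \<in> {1..N}. d dvd m} = N div d"
proof -
  have "{m \<in> {1..N}. d dvd m} = (\<lambda>k. d * k) ` {1..N div d}"
    using assms by (force simp: less_eq_div_iff_mult_less_eq mult.commute elim!: dvdE)
  then show ?thesis using assms by (simp add: card_image inj_on_def)
qed

text \<open>Legendre's formula for the exponent of \<open>p\<close> in \<open>fact N\<close>, by
  counting the pairs \<open>(m, j)\<close> with \<open>p ^ j dvd m\<close> in both orders.\<close>

lemma sum_multiplicity_eq:
  fixes p N :: nat
  assumes "prime p"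
  shows "(\<Sum>m=1..N. multiplicity p m) = (\<Sum>j=1..N. N div p ^ j)"
proof -
  have "(\<Sum>m=1..N. multiplicity p m) = (\<Sum>m=1..N. \<Sum>j=1..N. if p ^ j dvd m then 1 else 0)"
    using assms by (intro sum.cong multiplicity_eq_sum) auto
  also have "\<dots> = (\<Sum>j=1..N. \<Sum>m=1..N. if p ^ j dvd m then 1 else 0)" by (rule sum.swap)
  also have "\<dots> = (\<Sum>j=1..N. card {m \<in> {1..N}. p ^ j dvd m})"
    by (simp add: sum.If_cases Int_def)
  also have "\<dots> = (\<Sum>j=1..N. N div p ^ j)"
    using assms by (intro sum.cong card_multiples_upto) (auto dest: prime_gt_0_nat)
  finally show ?thesis .
qed

text \<open>The upper bound drops the floors in Legendre's formula and sums the geometric series;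
  the lower bound keeps only the term \<open>j = 1\<close>.\<close>

lemma sum_multiplicity_bounds:
  fixes p N :: nat
  assumes "prime p" "p \<le> N"
  shows "real (\<Sum>m=1..N. multiplicity p m) \<le> real N / (real p - 1)"
    and "real (\<Sum>m=1..N. multiplicity p m) \<ge> real N / real p - 1"
proof -
  have p: "p > 1" using assms by (auto dest: prime_gt_1_nat)
  have "real (\<Sum>j=1..N. N div p ^ j) = (\<Sum>j=1..N. real (N div p ^ j))" by simp
  also have "\<dots> \<le> (\<Sum>j=1..N. real N * (1 / real p) ^ j)"
    by (intro sum_mono order_trans[OF of_nat_div_le_of_nat]) (simp add: power_divide)
  also have "\<dots> = real N * ((\<Sum>j<Suc N. (1 / real p) ^ j) - 1)"
    by (subst sum.lessThan_Suc_shift) (simp add: sum_distrib_left sum.atLeast1_atMost_eq)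
  also have "\<dots> \<le> real N * (1 / (1 - 1 / real p) - 1)"
  proof (intro mult_left_mono diff_right_mono)
    have "(\<Sum>j<Suc N. (1 / real p) ^ j) = (1 - (1 / real p) ^ Suc N) / (1 - 1 / real p)"
      using p by (subst sum_gp_strict) auto
    also have "\<dots> \<le> 1 / (1 - 1 / real p)"
      using p by (intro divide_right_mono) auto
    finally show "(\<Sum>j<Suc N. (1 / real p) ^ j) \<le> 1 / (1 - 1 / real p)" .
  qed simp
  also have "\<dots> = real N / (real p - 1)"
    using p by (simp add: field_simps)
  finally show "real (\<Sum>m=1..N. multiplicity p m) \<le> real N / (real p - 1)"
    by (simp only: sum_multiplicity_eq[OF assms(1)])
  have "real N / real p - 1 \<le> real (N div p ^ 1)"
    using real_of_int_div3[of "int N" "int p"] by (simp flip: of_nat_div)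
  also have "N div p ^ 1 \<le> (\<Sum>j=1..N. N div p ^ j)"
    using assms p by (intro member_le_sum) auto
  finally show "real (\<Sum>m=1..N. multiplicity p m) \<ge> real N / real p - 1"
    by (simp only: sum_multiplicity_eq[OF assms(1)])
qed

lemma ln_eq_sum_multiplicity:
  assumes "m > 0" "m \<le> N"
  shows "ln (real m) = (\<Sum>p\<in>primes_upto N. real (multiplicity p m) * ln (real p))"
proof -
  have "real m = (\<Prod>p\<in>prime_factors m. real p ^ multiplicity p m)"
    using assms(1) by (subst prime_factorization_nat[of m]) auto
  then have "ln (real m) = (\<Sum>p\<in>prime_factors m. ln (real p ^ multiplicity p m))"
    by (simp only:) (subst ln_prod; auto dest: in_prime_factors_imp_prime prime_gt_0_nat)
  also have "\<dots> = (\<Sum>p\<in>prime_factors m. real (multiplicity p m) * ln (real p))"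
    by (intro sum.cong refl ln_realpow)
  also have "\<dots> = (\<Sum>p\<in>primes_upto N. real (multiplicity p m) * ln (real p))"
  proof (rule sum.mono_neutral_left)
    show "prime_factors m \<subseteq> primes_upto N"
      using assms by (auto simp: primes_upto_def prime_factors_dvd dest!: dvd_imp_le)
    show "\<forall>p\<in>primes_upto N - prime_factors m. real (multiplicity p m) * ln (real p) = 0"
      using assms by (auto simp: primes_upto_def prime_factors_multiplicity)
  qed simp
  finally show ?thesis .
qed

lemma ln_fact_eq_sum_primes:
  "ln (fact N) = (\<Sum>p\<in>primes_upto N. ln (real p) * real (\<Sum>m=1..N. multiplicity p m))"
proof -
  have "ln (fact N) = (\<Sum>m=1..N. ln (real m))"
    unfolding fact_prod of_nat_prod by (subst ln_prod) auto
  also have "\<dots> = (\<Sum>m=1..N. \<Sum>p\<in>primes_upto N. real (multiplicity p m) * ln (real p))"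
    by (intro sum.cong ln_eq_sum_multiplicity) auto
  also have "\<dots> = (\<Sum>p\<in>primes_upto N. \<Sum>m=1..N. real (multiplicity p m) * ln (real p))"
    by (rule sum.swap)
  finally show ?thesis by (simp add: sum_distrib_left mult.commute)
qed

text \<open>The lower bound holds because \<open>N ^ N / fact N\<close> is a single term of the
  series of \<open>exp N\<close>.\<close>

lemma ln_fact_bounds:
  shows "N > 0 \<Longrightarrow> ln (fact N) \<ge> real N * ln (real N) - real N"
    and "N > 0 \<Longrightarrow> ln (fact N) \<le> real N * ln (real N)"
proof -
  assume N: "N > 0"
  have "real N ^ N / fact N \<le> exp (real N)"
  proof -
    have "(\<lambda>n. real N ^ n /\<^sub>R fact n) sums exp (real N)" by (rule exp_converges)
    from sum_le_suminf[OF sums_summable[OF this], of "{N}"] sums_unique[OF this]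
    show ?thesis by (simp add: divide_inverse mult.commute)
  qed
  then have "real N ^ N \<le> exp (real N) * fact N" by (simp add: field_simps)
  then have "ln (real N ^ N) \<le> ln (exp (real N) * fact N)"
    using N by (subst ln_le_cancel_iff) auto
  then show "ln (fact N) \<ge> real N * ln (real N) - real N"
    using N by (simp add: ln_realpow ln_mult)
  have "ln (fact N :: real) \<le> ln (real N ^ N)"
    using N fact_le_power[of N, where ?'a = real] by (subst ln_le_cancel_iff) auto
  then show "ln (fact N) \<le> real N * ln (real N)"
    using N by (simp add: ln_realpow)
qed

text \<open>Telescoping against \<open>(ln n + 2) / n\<close>.\<close>

lemma sum_ln_div_le:
  assumes "N \<ge> 1"
  shows "(\<Sum>n=2..N. ln (real n) / (real n * (real n - 1))) \<le> 2 - (ln (real N) + 2) / real N"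
  using assms
proof (induction N rule: nat_induct_at_least)
  case (Suc N)
  define x where "x = real N"
  have x: "x \<ge> 1" using Suc by (simp add: x_def)
  have "ln (1 + 1 / x) \<le> 1 / x" using x by (intro ln_add_one_self_le_self) auto
  moreover have "ln (1 + 1 / x) = ln (x + 1) - ln x"
  proof -
    have "1 + 1 / x = (x + 1) / x" using x by (simp add: field_simps)
    then show ?thesis using x by (simp add: ln_div)
  qed
  ultimately have "(x + 1) * (ln (x + 1) - ln x) \<le> (x + 1) * (1 / x)"
    using x by (intro mult_left_mono) auto
  also have "\<dots> \<le> 2" using x by (simp add: field_simps)
  finally have "ln (x + 1) \<le> (x + 1) * (ln x + 2) - x * (ln (x + 1) + 2)"
    by (simp add: algebra_simps)
  then have "ln (x + 1) / ((x + 1) * x) \<le> ((x + 1) * (ln x + 2) - x * (ln (x + 1) + 2)) / ((x + 1) * x)"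
    using x by (intro divide_right_mono) auto
  also have "\<dots> = (ln x + 2) / x - (ln (x + 1) + 2) / (x + 1)"
    using x by (simp add: diff_divide_distrib)
  finally have "ln (x + 1) / ((x + 1) * x) \<le> (ln x + 2) / x - (ln (x + 1) + 2) / (x + 1)" .
  then show ?case using Suc by (simp add: x_def add.commute)
qed simp

lemma sum_primes_ln_div_le: "(\<Sum>p\<in>primes_upto N. ln (real p) / (real p * (real p - 1))) \<le> 2"
proof (cases "N \<ge> 1")
  case True
  have "(\<Sum>p\<in>primes_upto N. ln (real p) / (real p * (real p - 1)))
      \<le> (\<Sum>n=2..N. ln (real n) / (real n * (real n - 1)))"
    by (rule sum_mono2) (auto simp: primes_upto_def prime_ge_2_nat)
  also have "\<dots> \<le> 2 - (ln (real N) + 2) / real N" by (rule sum_ln_div_le[OF True])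
  also have "\<dots> \<le> 2" using True by simp
  finally show ?thesis .
next
  case False
  then have "primes_upto N = {}" by (auto simp: primes_upto_def dest: prime_gt_0_nat)
  then show ?thesis by simp
qed

section \<open>Logarithms of Euler factors\<close>

text \<open>Both bounds are \<open>ln x \<le> x - 1\<close>, applied to \<open>1 - q\<close> and to
  \<open>1 / (1 - q)\<close>.\<close>

lemma neg_ln_one_minus_bounds:
  fixes q :: real
  assumes "0 \<le> q" "q < 1"
  shows "q \<le> - ln (1 - q)" and "- ln (1 - q) \<le> q / (1 - q)"
proof -
  show "q \<le> - ln (1 - q)" using ln_le_minus_one[of "1 - q"] assms by simp
  have "- ln (1 - q) = ln (1 / (1 - q))" using assms by (simp add: ln_div)
  also have "\<dots> \<le> 1 / (1 - q) - 1" using assms by (intro ln_le_minus_one) auto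
  also have "\<dots> = q / (1 - q)" using assms by (simp add: field_simps)
  finally show "- ln (1 - q) \<le> q / (1 - q)" .
qed

definition euler_log :: "nat \<Rightarrow> real" where
  "euler_log n = (\<Sum>p\<in>primes_upto n. - ln (1 - 1 / real p))"

lemma euler_factor_bounds:
  assumes "prime (p :: nat)"
  shows "1 / real p \<le> - ln (1 - 1 / real p)" and "- ln (1 - 1 / real p) \<le> 1 / (real p - 1)"
    and "1 / (real p - 1) = 1 / real p + 1 / (real p * (real p - 1))"
proof -
  have p: "real p > 1" using prime_gt_1_nat[OF assms] by simp
  show "1 / real p \<le> - ln (1 - 1 / real p)" using p by (intro neg_ln_one_minus_bounds) auto
  have "- ln (1 - 1 / real p) \<le> (1 / real p) / (1 - 1 / real p)"
    using p by (intro neg_ln_one_minus_bounds) auto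
  also have "\<dots> = 1 / (real p - 1)" using p by (simp add: field_simps)
  finally show "- ln (1 - 1 / real p) \<le> 1 / (real p - 1)" .
  show "1 / (real p - 1) = 1 / real p + 1 / (real p * (real p - 1))"
    using p by (simp add: field_simps)
qed

text \<open>\<open>ln (fact N)\<close> is estimated both directly and through its prime
  factorization. The weight \<open>- ln (1 - 1 / p)\<close> replaces the customary
  \<open>1 / p\<close>, so that Abel summation leads straight to \<open>euler_log\<close>; the
  change of weight costs at most 2.\<close>

theorem mertens_first:
  assumes "N > 0"
  shows "\<bar>(\<Sum>p\<in>primes_upto N. - ln (1 - 1 / real p) * ln (real p)) - ln (real N)\<bar> \<le> 4"
proof -
  let ?g = "\<lambda>p::nat. - ln (1 - 1 / real p)"
  have pr: "prime p" "p \<le> N" "ln (real p) \<ge> 0" "real p > 1" if "p \<in> primes_upto N" for p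
    using that by (auto simp: primes_upto_def dest: prime_gt_1_nat)
  have "real N * (ln (real N) - 1) \<le> ln (fact N)"
    using ln_fact_bounds(1)[OF assms] by (simp add: algebra_simps)
  also have "\<dots> \<le> (\<Sum>p\<in>primes_upto N. ln (real p) * (real N / (real p - 1)))"
    unfolding ln_fact_eq_sum_primes
    by (intro sum_mono mult_left_mono sum_multiplicity_bounds) (auto simp: pr)
  also have "\<dots> = real N * (\<Sum>p\<in>primes_upto N. ln (real p) / (real p - 1))"
    by (simp add: sum_distrib_left mult.commute)
  finally have "ln (real N) - 1 \<le> (\<Sum>p\<in>primes_upto N. ln (real p) * (1 / (real p - 1)))"
    using assms by simp
  also have "\<dots> \<le> (\<Sum>p\<in>primes_upto N. ?g p * ln (real p) + ln (real p) / (real p * (real p - 1)))"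
  proof (rule sum_mono)
    fix p assume p: "p \<in> primes_upto N"
    have "1 / (real p - 1) \<le> ?g p + 1 / (real p * (real p - 1))"
      using euler_factor_bounds[of p] pr[OF p] by linarith
    from mult_left_mono[OF this pr(3)[OF p]]
    show "ln (real p) * (1 / (real p - 1)) \<le> ?g p * ln (real p) + ln (real p) / (real p * (real p - 1))"
      by (simp add: algebra_simps)
  qed
  also have "\<dots> \<le> (\<Sum>p\<in>primes_upto N. ?g p * ln (real p)) + 2"
    using sum_primes_ln_div_le[of N] by (simp only: sum.distrib)
  finally have lower: "ln (real N) - 3 \<le> (\<Sum>p\<in>primes_upto N. ?g p * ln (real p))" by simp
  have "(\<Sum>p\<in>primes_upto N. ln (real p) * (real N / real p - 1)) \<le> ln (fact N)"
    unfolding ln_fact_eq_sum_primes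
    by (intro sum_mono mult_left_mono sum_multiplicity_bounds) (auto simp: pr)
  also have "\<dots> \<le> real N * ln (real N)" by (rule ln_fact_bounds(2)[OF assms])
  finally have "real N * (\<Sum>p\<in>primes_upto N. ln (real p) / real p)
      \<le> real N * ln (real N) + (\<Sum>p\<in>primes_upto N. ln (real p))"
    by (simp add: algebra_simps sum_distrib_left sum_subtractf)
  \<comment> \<open>The sum of \<open>ln p\<close> is the total loss caused by the floors;
    Chebyshev's bound makes it \<open>O(N)\<close>.\<close>
  also have "\<dots> \<le> real N * (ln (real N) + ln 4)"
    using chebyshev_theta_le[of N] by (simp add: algebra_simps)
  finally have 1: "(\<Sum>p\<in>primes_upto N. ln (real p) / real p) \<le> ln (real N) + ln 4"
    using assms by simp
  have "(\<Sum>p\<in>primes_upto N. ?g p * ln (real p))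
      \<le> (\<Sum>p\<in>primes_upto N. ln (real p) / real p + ln (real p) / (real p * (real p - 1)))"
  proof (rule sum_mono)
    fix p assume p: "p \<in> primes_upto N"
    have "?g p \<le> 1 / real p + 1 / (real p * (real p - 1))"
      using euler_factor_bounds[of p] pr[OF p] by linarith
    from mult_left_mono[OF this pr(3)[OF p]]
    show "?g p * ln (real p) \<le> ln (real p) / real p + ln (real p) / (real p * (real p - 1))"
      by (simp add: algebra_simps)
  qed
  also have "\<dots> \<le> ln (real N) + ln 4 + 2"
    using sum_primes_ln_div_le[of N] 1 by (simp only: sum.distrib)
  also have "ln 4 \<le> (2::real)"
    using ln_le_minus_one[of 2] ln_realpow[of 2 2] by simp
  finally show ?thesis using lower by linarith
qed

subsection \<open>Mertens' third theorem\<close>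

text \<open>Abel summation in the form of an inequality: an ordering of partial sums survives
  nonnegative decreasing weights.\<close>

lemma sum_mult_antimono_mono:
  fixes a d f :: "nat \<Rightarrow> real"
  assumes partial: "\<And>k. k \<le> n \<Longrightarrow> (\<Sum>j\<le>k. d j) \<le> (\<Sum>j\<le>k. a j)"
    and f_dec: "\<And>j. f (Suc j) \<le> f j" and f_nonneg: "\<And>j. f j \<ge> 0"
  shows "(\<Sum>j\<le>n. d j * f j) \<le> (\<Sum>j\<le>n. a j * f j)"
proof -
  define c where "c j = a j - d j" for j
  have C: "(\<Sum>j\<le>k. c j) \<ge> 0" if "k \<le> n" for k
    using partial[OF that] by (simp add: c_def sum_subtractf)
  \<comment> \<open>This is stronger than nonnegativity of the weighted sum and is what makes the
    induction go through.\<close>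
  have "(\<Sum>j\<le>k. c j) * f k \<le> (\<Sum>j\<le>k. c j * f j)" if "k \<le> n" for k
    using that
  proof (induction k)
    case (Suc k)
    have "(\<Sum>j\<le>Suc k. c j) * f (Suc k) = (\<Sum>j\<le>k. c j) * f (Suc k) + c (Suc k) * f (Suc k)"
      by (simp add: algebra_simps)
    also have "(\<Sum>j\<le>k. c j) * f (Suc k) \<le> (\<Sum>j\<le>k. c j) * f k"
      using C[of k] Suc.prems f_dec by (intro mult_left_mono) auto
    also have "\<dots> \<le> (\<Sum>j\<le>k. c j * f j)" using Suc by simp
    finally show ?case by simp
  qed simp
  from this[of n] C[of n] f_nonneg[of n] have "0 \<le> (\<Sum>j\<le>n. c j * f j)"
    by (meson mult_nonneg_nonneg order_refl order_trans)
  then show ?thesis by (simp add: c_def left_diff_distrib sum_subtractf)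
qed

text \<open>Abel summation with weights \<open>1 / ln\<close> applied to Mertens' first theorem. Of
  the constant 9, the errors of that theorem at the two ends account for 8, and the comparison of a
  sum with the integral of \<open>1 / u\<close> for 1.\<close>

theorem euler_log_increment:
  assumes "2 \<le> x" "x \<le> m"
  shows "euler_log m - ln (ln (real m)) \<ge> euler_log x - ln (ln (real x)) - 9 / ln (real x)"
proof -
  define g where "g p = - ln (1 - 1 / real p)" for p :: nat
  define A where "A n = (\<Sum>p\<in>primes_upto n. g p * ln (real p))" for n
  \<comment> \<open>The value \<open>a 0 = 8\<close> absorbs the error terms of Mertens' first theorem at both ends.\<close>
  define a where "a j = (if j = 0 then 8 else if prime (x + j) then g (x + j) * ln (real (x + j)) else 0)" for j
  define d where "d j = (if j = 0 then 0 else ln (real (x + j)) - ln (real (x + j - 1)))" for j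
  define f where "f j = 1 / ln (real (x + j))" for j
  have pos: "ln (real (x + j)) > 0" for j using assms by simp
  have A: "\<bar>A n - ln (real n)\<bar> \<le> 4" if "n > 0" for n
    using mertens_first[OF that] by (simp add: A_def g_def)
  have sum_a: "(\<Sum>j\<le>k. a j) = 8 + A (x + k) - A x" for k
    by (induction k) (simp_all add: a_def A_def sum_primes_upto_Suc)
  have sum_d: "(\<Sum>j\<le>k. d j) = ln (real (x + k)) - ln (real x)" for k
    by (induction k) (simp_all add: d_def)
  have sum_af: "(\<Sum>j\<le>k. a j * f j) = 8 / ln (real x) + euler_log (x + k) - euler_log x" for k
  proof (induction k)
    case (Suc k)
    have "a (Suc k) * f (Suc k) = (if prime (x + Suc k) then g (x + Suc k) else 0)"
      using pos[of "Suc k"] by (simp add: a_def f_def)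
    moreover have "euler_log (x + Suc k) = euler_log (x + k) + (if prime (x + Suc k) then g (x + Suc k) else 0)"
      using sum_primes_upto_Suc[of g "x + k"] by (simp add: euler_log_def g_def)
    ultimately show ?case using Suc by simp
  qed (simp add: a_def f_def)
  \<comment> \<open>With \<open>u\<close> and \<open>w\<close> consecutive logarithms,
    \<open>(w - u) / w\<close> is a lower Riemann sum term for the integral of \<open>1 / u\<close>.
    As \<open>w - u \<le> 1\<close>, its deficit is at most \<open>1 / u - 1 / w\<close>, which
    telescopes to \<open>f 0 - f k\<close>.\<close>
  have sum_df: "(\<Sum>j\<le>k. d j * f j) \<ge> ln (ln (real (x + k))) - ln (ln (real x)) - (f 0 - f k)" for k
  proof (induction k)
    case (Suc k)
    define u where "u = ln (real (x + k))"
    define w where "w = ln (real (x + Suc k))"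
    have u: "u > 0" unfolding u_def by (rule pos)
    have uw: "u \<le> w" using assms by (simp add: u_def w_def)
    have "w - u \<le> 1"
    proof -
      have "w - u = ln (real (x + Suc k) / real (x + k))"
        unfolding u_def w_def using assms by (subst ln_div) auto
      also have "\<dots> \<le> real (x + Suc k) / real (x + k) - 1"
        using assms by (intro ln_le_minus_one) auto
      also have "\<dots> \<le> 1" using assms by (simp add: field_simps)
      finally show ?thesis .
    qed
    moreover have "1 / w \<le> 1 / u" using u uw by (simp add: frac_le)
    ultimately have "(w - u) * (1 / u - 1 / w) \<le> 1 * (1 / u - 1 / w)"
      by (intro mult_right_mono) auto
    moreover have "ln w - ln u \<le> (w - u) * (1 / u)"
    proof -
      have "ln w - ln u = ln (w / u)" using u uw by (simp add: ln_div)
      also have "\<dots> \<le> w / u - 1" using u uw by (intro ln_le_minus_one) auto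
      finally show ?thesis using u by (simp add: field_simps)
    qed
    ultimately have "ln w - ln u - (1 / u - 1 / w) \<le> (w - u) * (1 / w)"
      by (simp add: right_diff_distrib)
    moreover have "d (Suc k) * f (Suc k) = (w - u) * (1 / w)"
      by (simp add: d_def f_def u_def w_def)
    moreover have "(\<Sum>j\<le>Suc k. d j * f j) = (\<Sum>j\<le>k. d j * f j) + d (Suc k) * f (Suc k)" by simp
    moreover have "f (Suc k) = 1 / w" "f k = 1 / u" by (simp_all add: f_def u_def w_def)
    ultimately show ?case using Suc unfolding u_def[symmetric] w_def[symmetric] by linarith
  qed (simp add: d_def)
  define k where "k = m - x"
  have m: "m = x + k" using assms by (simp add: k_def)
  have "(\<Sum>j\<le>k. d j * f j) \<le> (\<Sum>j\<le>k. a j * f j)"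
  proof (rule sum_mult_antimono_mono)
    show "(\<Sum>j\<le>i. d j) \<le> (\<Sum>j\<le>i. a j)" for i
      using A[of x] A[of "x + i"] assms unfolding sum_a sum_d by linarith
    show "f (Suc j) \<le> f j" "f j \<ge> 0" for j
      using assms pos[of j] unfolding f_def by (auto intro!: frac_le)
  qed
  with sum_df[of k] have "ln (ln (real m)) - ln (ln (real x)) - (f 0 - f k)
      \<le> 8 / ln (real x) + euler_log m - euler_log x"
    unfolding sum_af m by linarith
  moreover have "f 0 = 1 / ln (real x)" "f k \<ge> 0" using pos[of k] by (simp_all add: f_def)
  moreover have "9 / ln (real x) = 8 / ln (real x) + 1 / ln (real x)" by (simp add: add_divide_distrib[symmetric])
  ultimately show ?thesis by linarith
qed

section \<open>Finite Euler products and zeta near 1\<close>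

lemma bij_betw_prime_powers:
  fixes P :: "nat set"
  assumes "finite P" "\<And>p. p \<in> P \<Longrightarrow> prime p"
  shows "bij_betw (\<lambda>e. \<Prod>p\<in>P. p ^ e p) (P \<rightarrow>\<^sub>E {..<J})
           {n. n > 0 \<and> prime_factors n \<subseteq> P \<and> (\<forall>p\<in>P. multiplicity p n < J)}"
    (is "bij_betw ?F ?E ?A")
proof (rule bij_betw_byWitness[where f' = "\<lambda>n. \<lambda>p\<in>P. multiplicity p n"])
  have mult: "multiplicity q (?F e) = (if q \<in> P then e q else 0)" if "prime q" for q e
    using assms that by (intro multiplicity_prod_prime_powers) auto
  show "\<forall>e\<in>?E. (\<lambda>p\<in>P. multiplicity p (?F e)) = e"
  proof
    fix e assume "e \<in> ?E"
    then show "(\<lambda>p\<in>P. multiplicity p (?F e)) = e"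
      using mult assms by (intro ext) (auto simp: restrict_def PiE_def extensional_def)
  qed
  show "\<forall>n\<in>?A. ?F (\<lambda>p\<in>P. multiplicity p n) = n"
  proof
    fix n assume n: "n \<in> ?A"
    have "?F (\<lambda>p\<in>P. multiplicity p n) = (\<Prod>p\<in>P. p ^ multiplicity p n)" by simp
    also have "\<dots> = (\<Prod>p\<in>prime_factors n. p ^ multiplicity p n)"
      using n assms by (intro prod.mono_neutral_right) (auto simp: prime_factors_multiplicity)
    also have "\<dots> = n" using n by (simp add: prime_factorization_nat[symmetric])
    finally show "?F (\<lambda>p\<in>P. multiplicity p n) = n" .
  qed
  show "?F ` ?E \<subseteq> ?A"
  proof safe
    fix e assume e: "e \<in> ?E"
    show "?F e > 0" using assms by (auto intro!: prod_pos dest: prime_gt_0_nat)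
    show "q \<in> P" if "q \<in> prime_factors (?F e)" for q
    proof -
      have "prime q" "multiplicity q (?F e) > 0" using that by (auto simp: prime_factors_multiplicity)
      then show ?thesis using mult[of q e] by (auto split: if_splits)
    qed
    show "multiplicity p (?F e) < J" if "p \<in> P" for p
      using mult[of p e] that assms e by auto
  qed
  show "(\<lambda>n. \<lambda>p\<in>P. multiplicity p n) ` ?A \<subseteq> ?E" by auto
qed

text \<open>Expanding the product and unique factorization. The cut-off \<open>J\<close> keeps all
  sums finite; it tends to infinity in the bound for zeta, and equals \<open>t\<close> for the
  divisors of a \<open>t\<close>-free number.\<close>

lemma finite_euler_product:
  fixes P :: "nat set" and f :: "nat \<Rightarrow> real"
  assumes "finite P" "\<And>p. p \<in> P \<Longrightarrow> prime p"
    and f_one: "f 1 = 1" and f_mult: "\<And>m n. f (m * n) = f m * f n"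
  shows "(\<Prod>p\<in>P. \<Sum>j<J. f p ^ j) =
           (\<Sum>n | n > 0 \<and> prime_factors n \<subseteq> P \<and> (\<forall>p\<in>P. multiplicity p n < J). f n)"
    and "finite {n. n > 0 \<and> prime_factors n \<subseteq> P \<and> (\<forall>p\<in>P. multiplicity p n < J)}"
proof -
  have f_pow: "f (n ^ k) = f n ^ k" for n k
    using f_one by (induction k) (auto simp: f_mult)
  have f_prod: "f (\<Prod>p\<in>B. h p) = (\<Prod>p\<in>B. f (h p))" for B and h :: "nat \<Rightarrow> nat"
    using f_one by (induction B rule: infinite_finite_induct) (auto simp: f_mult)
  note bij = bij_betw_prime_powers[OF assms(1,2), of J]
  have "(\<Prod>p\<in>P. \<Sum>j<J. f p ^ j) = (\<Sum>e\<in>P \<rightarrow>\<^sub>E {..<J}. \<Prod>p\<in>P. f p ^ e p)"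
    using assms(1) by (intro prod_sum_PiE) auto
  also have "\<dots> = (\<Sum>e\<in>P \<rightarrow>\<^sub>E {..<J}. f (\<Prod>p\<in>P. p ^ e p))"
    by (simp add: f_prod f_pow)
  also have "\<dots> = (\<Sum>n | n > 0 \<and> prime_factors n \<subseteq> P \<and> (\<forall>p\<in>P. multiplicity p n < J). f n)"
    by (rule sum.reindex_bij_betw[OF bij])
  finally show "(\<Prod>p\<in>P. \<Sum>j<J. f p ^ j) =
      (\<Sum>n | n > 0 \<and> prime_factors n \<subseteq> P \<and> (\<forall>p\<in>P. multiplicity p n < J). f n)" .
  have "finite (P \<rightarrow>\<^sub>E {..<J})" using assms(1) by (intro finite_PiE) auto
  then show "finite {n. n > 0 \<and> prime_factors n \<subseteq> P \<and> (\<forall>p\<in>P. multiplicity p n < J)}"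
    using bij_betw_finite[OF bij] by simp
qed

text \<open>Integral comparison done by telescoping: each new term is at most the decrease of
  \<open>N powr - \<delta> / \<delta>\<close>.\<close>

lemma sum_powr_le:
  fixes \<delta> :: real
  assumes "\<delta> > 0" "N \<ge> 1"
  shows "(\<Sum>n=1..N. real n powr - (1 + \<delta>)) \<le> 1 + (1 - real N powr - \<delta>) / \<delta>"
  using assms(2)
proof (induction N rule: nat_induct_at_least)
  case (Suc N)
  define y where "y = 1 / real (Suc N)"
  have y: "0 < y" "y < 1" using Suc by (simp_all add: y_def)
  \<comment> \<open>A Bernoulli inequality,
    \<open>1 + \<delta> * y \<le> (1 - y) powr - \<delta>\<close>; the choice of \<open>y\<close>
    gives \<open>Suc N * (1 - y) = N\<close>.\<close>
  have "1 + \<delta> * y \<le> 1 + \<delta> * (- ln (1 - y))"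
    using y assms neg_ln_one_minus_bounds(1)[of y] by (intro add_left_mono mult_left_mono) auto
  also have "\<dots> \<le> exp (\<delta> * (- ln (1 - y)))" by (rule exp_ge_add_one_self)
  also have "\<dots> = (1 - y) powr - \<delta>" using y by (simp add: powr_def)
  finally have "real (Suc N) powr - \<delta> * (1 + \<delta> * y) \<le> real (Suc N) powr - \<delta> * (1 - y) powr - \<delta>"
    by (intro mult_left_mono) auto
  also have "\<dots> = (real (Suc N) * (1 - y)) powr - \<delta>" using y by (subst powr_mult) auto
  also have "real (Suc N) * (1 - y) = real N" by (simp add: y_def field_simps)
  finally have "real (Suc N) powr - \<delta> * y * \<delta> \<le> real N powr - \<delta> - real (Suc N) powr - \<delta>"
    by (simp add: algebra_simps)
  then have "real (Suc N) powr - \<delta> * y \<le> (real N powr - \<delta> - real (Suc N) powr - \<delta>) / \<delta>"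
    using assms by (simp add: pos_le_divide_eq)
  moreover have "real (Suc N) powr - (1 + \<delta>) = real (Suc N) powr - \<delta> * y"
  proof -
    have "real (Suc N) powr - (1 + \<delta>) = real (Suc N) powr (- \<delta> + - 1)" by (simp add: add.commute)
    also have "\<dots> = real (Suc N) powr - \<delta> * real (Suc N) powr - 1" by (rule powr_add)
    also have "real (Suc N) powr - 1 = y" unfolding y_def by (subst powr_minus_divide) simp
    finally show ?thesis .
  qed
  ultimately show ?case using Suc by (simp add: diff_divide_distrib)
qed simp

text \<open>A truncated Euler product is a sum of \<open>n powr - (1 + \<delta>)\<close> over
  distinct \<open>n\<close>, hence bounded by the preceding estimate for zeta partial sums. Then
  \<open>J\<close> tends to infinity while the set of primes stays fixed.\<close>

lemma sum_neg_ln_primes_le: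
  fixes \<delta> :: real
  assumes "\<delta> > 0"
  shows "(\<Sum>p\<in>primes_upto N. - ln (1 - real p powr - (1 + \<delta>))) \<le> ln (1 + 1 / \<delta>)"
proof -
  let ?P = "primes_upto N"
  define f where "f n = real n powr - (1 + \<delta>)" for n :: nat
  have f1: "f 1 = 1" and fm: "f (m * n) = f m * f n" for m n by (simp_all add: f_def powr_mult)
  have P: "prime p" if "p \<in> ?P" for p using that by (simp add: primes_upto_def)
  have fp: "0 < f p" "f p < 1" if "p \<in> ?P" for p
  proof -
    have "real p > 1" using prime_gt_1_nat[OF P[OF that]] by simp
    then show "0 < f p" "f p < 1" using assms by (auto simp: f_def powr_less_one)
  qed
  have *: "(\<Prod>p\<in>?P. \<Sum>j<J. f p ^ j) \<le> 1 + 1 / \<delta>" for J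
  proof -
    define A where "A = {n. n > 0 \<and> prime_factors n \<subseteq> ?P \<and> (\<forall>p\<in>?P. multiplicity p n < J)}"
    have A: "finite A" unfolding A_def using P f1 fm by (intro finite_euler_product(2)[of _ f]) auto
    \<comment> \<open>Inserting 1 gives \<open>X \<ge> 1\<close> even if \<open>A\<close> is empty,
      which can happen for \<open>J = 0\<close>.\<close>
    define X where "X = Max (insert 1 A)"
    have X: "X \<ge> 1" unfolding X_def using A by (intro Max_ge) auto
    have "(\<Prod>p\<in>?P. \<Sum>j<J. f p ^ j) = (\<Sum>n\<in>A. f n)"
      unfolding A_def using P f1 fm by (intro finite_euler_product(1)) auto
    also have "\<dots> \<le> (\<Sum>n=1..X. f n)"
    proof (rule sum_mono2)
      show "A \<subseteq> {1..X}" using A by (auto simp: X_def A_def Suc_le_eq intro!: Max_ge)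
    qed (auto simp: f_def)
    also have "\<dots> \<le> 1 + (1 - real X powr - \<delta>) / \<delta>"
      unfolding f_def by (rule sum_powr_le[OF assms X])
    also have "\<dots> \<le> 1 + 1 / \<delta>" using assms by (intro add_left_mono divide_right_mono) auto
    finally show ?thesis .
  qed
  have "(\<lambda>J. \<Prod>p\<in>?P. \<Sum>j<J. f p ^ j) \<longlonglongrightarrow> (\<Prod>p\<in>?P. 1 / (1 - f p))"
  proof (rule tendsto_prod)
    fix p assume "p \<in> ?P"
    then have "(\<lambda>j. f p ^ j) sums (1 / (1 - f p))" using fp[of p] by (intro geometric_sums) auto
    then show "(\<lambda>J. \<Sum>j<J. f p ^ j) \<longlonglongrightarrow> 1 / (1 - f p)" by (simp add: sums_def)
  qed
  then have le: "(\<Prod>p\<in>?P. 1 / (1 - f p)) \<le> 1 + 1 / \<delta>"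
    by (rule LIMSEQ_le_const2) (use * in auto)
  have "(\<Sum>p\<in>?P. - ln (1 - f p)) = (\<Sum>p\<in>?P. ln (1 / (1 - f p)))"
    using fp by (intro sum.cong) (auto simp: ln_div)
  also have "\<dots> = ln (\<Prod>p\<in>?P. 1 / (1 - f p))"
    using fp by (intro ln_prod[symmetric]) (auto simp: less_imp_neq)
  also have "\<dots> \<le> ln (1 + 1 / \<delta>)"
    using le fp assms by (subst ln_le_cancel_iff) (auto intro!: prod_pos add_pos_pos)
  finally show ?thesis by (simp add: f_def)
qed

text \<open>Convexity of \<open>u \<mapsto> - ln (1 - q * u)\<close>: its graph lies above the tangent at \<open>u = 1\<close>.\<close>

lemma neg_ln_one_minus_mult_le:
  fixes q u :: real
  assumes "0 \<le> q" "q < 1" "0 \<le> u" "u \<le> 1"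
  shows "- ln (1 - q) * u \<le> - ln (1 - q * u) + (1 - u) * (q / (1 - q) - q)"
proof -
  have qu: "q * u \<le> q" using assms by (simp add: mult_left_le)
  then have "q * u < 1" using assms by linarith
  then have "ln (1 - q * u) - ln (1 - q) = ln ((1 - q * u) / (1 - q))"
    using assms by (simp add: ln_div)
  also have "\<dots> \<le> (1 - q * u) / (1 - q) - 1"
    using assms \<open>q * u < 1\<close> by (intro ln_le_minus_one) auto
  also have "\<dots> = (1 - u) * (q / (1 - q))" using assms by (simp add: field_simps)
  finally have "ln (1 - q * u) - ln (1 - q) \<le> (1 - u) * (q / (1 - q))" .
  moreover have "(1 - u) * q \<le> (1 - u) * (- ln (1 - q))"
    using assms neg_ln_one_minus_bounds(1)[of q] by (intro mult_left_mono) auto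
  ultimately show ?thesis by (simp add: algebra_simps)
qed

text \<open>The weight \<open>u = p powr - \<delta>\<close> is moved inside the logarithm by the
  tangent inequality with \<open>q = 1 / p\<close>. Since
  \<open>1 - u \<le> \<delta> * ln p\<close>, the cost is \<open>\<delta>\<close> times a sum
  bounded by 2.\<close>

lemma sum_euler_log_powr_le:
  fixes \<delta> :: real
  assumes "\<delta> > 0"
  shows "(\<Sum>p\<in>primes_upto N. - ln (1 - 1 / real p) * real p powr - \<delta>) \<le> ln (1 + 1 / \<delta>) + 2 * \<delta>"
proof -
  have "(\<Sum>p\<in>primes_upto N. - ln (1 - 1 / real p) * real p powr - \<delta>) \<le>
     (\<Sum>p\<in>primes_upto N. - ln (1 - real p powr - (1 + \<delta>)) + \<delta> * (ln (real p) / (real p * (real p - 1))))"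
  proof (rule sum_mono)
    fix p assume "p \<in> primes_upto N"
    then have pr: "prime p" by (simp add: primes_upto_def)
    then have p: "real p > 1" using prime_gt_1_nat[OF pr] by simp
    define u where "u = real p powr - \<delta>"
    have u: "0 \<le> u" "u \<le> 1" using p assms by (auto simp: u_def powr_minus ge_one_powr_ge_zero inverse_le_1_iff)
    have "1 + - (\<delta> * ln (real p)) \<le> exp (- (\<delta> * ln (real p)))" by (rule exp_ge_add_one_self)
    then have u': "1 - u \<le> \<delta> * ln (real p)" using p by (simp add: u_def powr_def)
    have "- ln (1 - 1 / real p) * u \<le>
        - ln (1 - 1 / real p * u) + (1 - u) * (1 / real p / (1 - 1 / real p) - 1 / real p)"
      using p u by (intro neg_ln_one_minus_mult_le) auto
    also have "1 / real p / (1 - 1 / real p) - 1 / real p = 1 / (real p * (real p - 1))"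
      using p by (simp add: field_simps)
    also have "(1 - u) * (1 / (real p * (real p - 1))) \<le> (\<delta> * ln (real p)) * (1 / (real p * (real p - 1)))"
      using u' p by (intro mult_right_mono) auto
    also have "1 / real p * u = real p powr - (1 + \<delta>)"
      using p by (simp add: u_def powr_diff powr_minus_divide)
    finally show "- ln (1 - 1 / real p) * real p powr - \<delta> \<le>
        - ln (1 - real p powr - (1 + \<delta>)) + \<delta> * (ln (real p) / (real p * (real p - 1)))"
      by (simp add: u_def)
  qed
  also have "\<dots> = (\<Sum>p\<in>primes_upto N. - ln (1 - real p powr - (1 + \<delta>)))
      + \<delta> * (\<Sum>p\<in>primes_upto N. ln (real p) / (real p * (real p - 1)))"
    by (simp only: sum.distrib sum_distrib_left)
  also have "\<dots> \<le> ln (1 + 1 / \<delta>) + \<delta> * 2"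
    using assms by (intro add_mono sum_neg_ln_primes_le mult_left_mono sum_primes_ln_div_le) auto
  finally show ?thesis by simp
qed

lemma euler_factor_nonneg: "prime (p :: nat) \<Longrightarrow> 0 \<le> - ln (1 - 1 / real p)"
  using euler_factor_bounds(1)[of p] by (meson divide_nonneg_nonneg of_nat_0_le_iff order_trans zero_le_one)

lemma euler_log_nonneg: "0 \<le> euler_log n"
  unfolding euler_log_def by (intro sum_nonneg euler_factor_nonneg) (simp add: primes_upto_def)

lemma ln_ln_mono:
  fixes u v :: real
  shows "1 < u \<Longrightarrow> u \<le> v \<Longrightarrow> ln (ln u) \<le> ln (ln v)"
  by (intro ln_mono) auto

section \<open>Comparison with harmonic numbers\<close>

text \<open>The sum may start at 0 because \<open>1 / real 0 = 0\<close>; the same convention is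
  used for the logarithmic series below.\<close>

lemma harm_eq_sum_atMost: "harm k = (\<Sum>j\<le>k. 1 / real j)"
  by (induction k) (simp_all add: harm_Suc harm_expand(1) divide_inverse)

lemma neg_ln_one_minus_sums:
  fixes q :: real
  assumes "0 < q" "q < 1"
  shows "(\<lambda>n. \<Sum>j\<le>n. q ^ j / real j) \<longlonglongrightarrow> - ln (1 - q)"
proof -
  have "(\<lambda>n. - (q ^ n) / real n) sums ln (1 - q)"
    using ln_series'[of "- q"] assms by simp
  then have "(\<lambda>n. q ^ n / real n) sums - ln (1 - q)"
    using sums_minus by fastforce
  then show ?thesis by (simp add: sums_def_le)
qed

text \<open>The primes are grouped into the ranges \<open>exp (j - 1) < p \<le> exp j\<close>.\<close>

lemma sum_euler_log_blocks_le:
  fixes \<delta> :: real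
  assumes "\<delta> > 0"
  defines "E \<equiv> \<lambda>k. nat \<lfloor>exp (real k)\<rfloor>"
  shows "(\<Sum>j\<le>n. (if j = 0 then 0 else euler_log (E j) - euler_log (E (j - 1))) * exp (- \<delta>) ^ j)
    \<le> (\<Sum>p\<in>primes_upto (E n). - ln (1 - 1 / real p) * real p powr - \<delta>)"
proof (induction n)
  case 0
  have "0 \<le> (\<Sum>p\<in>primes_upto (E 0). - ln (1 - 1 / real p) * real p powr - \<delta>)"
    by (intro sum_nonneg mult_nonneg_nonneg euler_factor_nonneg) (auto simp: primes_upto_def)
  then show ?case by simp
next
  case (Suc n)
  let ?g = "\<lambda>p::nat. - ln (1 - 1 / real p)"
  define D where "D = primes_upto (E (Suc n)) - primes_upto (E n)"
  have sub: "primes_upto (E n) \<subseteq> primes_upto (E (Suc n))"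
    by (auto simp: primes_upto_def E_def intro: order_trans[OF _ nat_mono[OF floor_mono]])
  have split: "sum h (primes_upto (E (Suc n))) = sum h D + sum h (primes_upto (E n))" for h :: "nat \<Rightarrow> real"
    unfolding D_def by (rule sum.subset_diff[OF sub]) simp
  have "(euler_log (E (Suc n)) - euler_log (E n)) * exp (- \<delta>) ^ Suc n = (\<Sum>p\<in>D. ?g p * exp (- \<delta>) ^ Suc n)"
    by (simp add: euler_log_def split sum_distrib_right)
  also have "\<dots> \<le> (\<Sum>p\<in>D. ?g p * real p powr - \<delta>)"
  proof (intro sum_mono mult_left_mono)
    fix p assume "p \<in> D"
    then have p: "prime p" "p \<le> E (Suc n)" by (auto simp: D_def primes_upto_def)
    then show "0 \<le> ?g p" by (intro euler_factor_nonneg)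
    have "real p > 0" using p prime_gt_0_nat by simp
    moreover have "real p \<le> exp (real (Suc n))"
      using p(2) unfolding E_def by (simp add: le_nat_floor le_nat_iff le_floor_iff)
    ultimately have "exp (real (Suc n)) powr - \<delta> \<le> real p powr - \<delta>"
      using assms by (intro powr_mono2') auto
    also have "exp (real (Suc n)) powr - \<delta> = exp (- \<delta>) ^ Suc n"
      unfolding powr_def exp_of_nat_mult[symmetric] by simp
    finally show "exp (- \<delta>) ^ Suc n \<le> real p powr - \<delta>" .
  qed
  finally show ?case using Suc by (simp add: split)
qed

theorem mertens_third_upper:
  assumes "x \<ge> 2"
  shows "euler_log x \<le> ln (ln (real x)) + euler_mascheroni + 9 / ln (real x)"
proof (rule ccontr)
  assume neg: "\<not> ?thesis"
  define E where "E k = nat \<lfloor>exp (real k)\<rfloor>" for k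
  \<comment> \<open>Half of the assumed excess; the other half absorbs the replacement of
    \<open>ln (ln (E k)) + euler_mascheroni\<close> by \<open>harm k\<close>.\<close>
  define \<eta> where "\<eta> = (euler_log x - ln (ln (real x)) - euler_mascheroni - 9 / ln (real x)) / 2"
  have \<eta>: "\<eta> > 0" using neg by (simp add: \<eta>_def)
  have two_\<eta>: "2 * \<eta> = euler_log x - ln (ln (real x)) - euler_mascheroni - 9 / ln (real x)"
    unfolding \<eta>_def by (metis field_sum_of_halves mult_2)
  have big: "euler_log m \<ge> ln (ln (real m)) + euler_mascheroni + 2 * \<eta>" if "m \<ge> x" for m
    using euler_log_increment[OF assms that] two_\<eta> by linarith
  have "eventually (\<lambda>k. euler_log (E k) \<ge> harm k + \<eta>) sequentially"
  proof -
    \<comment> \<open>\<open>exp k - 1\<close> is a lower bound for the floor \<open>E k\<close>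
      whose asymptotics are explicit.\<close>
    have "(\<lambda>k. (harm k - ln (real k)) + (ln (real k) - ln (ln (exp (real k) - 1)))) \<longlonglongrightarrow> euler_mascheroni + 0"
      by (intro tendsto_add euler_mascheroni_LIMSEQ) real_asymp
    then have "eventually (\<lambda>k. (harm k - ln (real k)) + (ln (real k) - ln (ln (exp (real k) - 1)))
        < euler_mascheroni + \<eta>) sequentially"
      using \<eta> by (intro order_tendstoD) auto
    moreover have "eventually (\<lambda>k. exp (real k) - 1 > max 3 (real x)) sequentially"
      by real_asymp
    ultimately show ?thesis
    proof eventually_elim
      case (elim k)
      have le: "exp (real k) - 1 \<le> real (E k)" unfolding E_def by linarith
      then have "E k \<ge> x" using elim by linarith
      then have "euler_log (E k) \<ge> ln (ln (real (E k))) + euler_mascheroni + 2 * \<eta>" by (rule big)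
      moreover have "ln (ln (exp (real k) - 1)) \<le> ln (ln (real (E k)))"
        using le elim by (intro ln_ln_mono) linarith+
      ultimately show ?case using elim by linarith
    qed
  qed
  then obtain k0 where k0: "\<And>k. k \<ge> k0 \<Longrightarrow> euler_log (E k) \<ge> harm k + \<eta>"
    by (auto simp: eventually_sequentially)
  define C where "C = (harm k0 :: real)"
  define a where "a j = (if j = 0 then 0 else euler_log (E j) - euler_log (E (j - 1)))" for j
  \<comment> \<open>The partial sums of \<open>d\<close> are \<open>harm k - C \<le> 0\<close> before \<open>k0\<close> and \<open>harm k + \<eta>\<close> from \<open>k0\<close> on
    (note \<open>1 / real 0 = 0\<close>).\<close>
  define d where "d j = 1 / real j + (if j = 0 then - C else 0) + (if j = k0 then C + \<eta> else 0)" for j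
  have "primes_upto (E 0) = {}" by (auto simp: primes_upto_def E_def dest: prime_gt_1_nat)
  then have E0: "euler_log (E 0) = 0" by (simp add: euler_log_def)
  have sum_a: "(\<Sum>j\<le>k. a j) = euler_log (E k)" for k
    by (induction k) (simp_all add: a_def E0)
  have partial: "(\<Sum>j\<le>k. d j) \<le> (\<Sum>j\<le>k. a j)" for k
  proof -
    have "(\<Sum>j\<le>k. d j) = harm k - C + (if k0 \<le> k then C + \<eta> else 0)"
      by (simp add: d_def sum.distrib harm_eq_sum_atMost)
    also have "\<dots> \<le> euler_log (E k)"
    proof (cases "k0 \<le> k")
      case False
      then have "harm k \<le> C" unfolding C_def by (intro harm_mono) auto
      then show ?thesis using False euler_log_nonneg[of "E k"] by simp
    qed (use k0 in simp)
    finally show ?thesis by (simp add: sum_a)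
  qed
  \<comment> \<open>Abel comparison of \<open>d\<close> and \<open>a\<close> with the weights
    \<open>exp (- \<delta>) ^ j\<close>, followed by \<open>n\<close> tending to infinity.\<close>
  have main: "- ln (1 - exp (- \<delta>)) - C + (C + \<eta>) * exp (- \<delta>) ^ k0 \<le> ln (1 + 1 / \<delta>) + 2 * \<delta>"
    if \<delta>: "\<delta> > 0" for \<delta> :: real
  proof (rule LIMSEQ_le_const2)
    let ?q = "exp (- \<delta>)"
    show "(\<lambda>n. (\<Sum>j\<le>n. ?q ^ j / real j) - C + (C + \<eta>) * ?q ^ k0)
        \<longlonglongrightarrow> - ln (1 - ?q) - C + (C + \<eta>) * ?q ^ k0"
      using \<delta> by (intro tendsto_intros neg_ln_one_minus_sums) auto
    show "\<exists>N. \<forall>n\<ge>N. (\<Sum>j\<le>n. ?q ^ j / real j) - C + (C + \<eta>) * ?q ^ k0 \<le> ln (1 + 1 / \<delta>) + 2 * \<delta>"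
    proof (intro exI[of _ k0] allI impI)
      fix n assume n: "n \<ge> k0"
      have "(\<Sum>j\<le>n. ?q ^ j / real j) - C + (C + \<eta>) * ?q ^ k0 = (\<Sum>j\<le>n. d j * ?q ^ j)"
        using n by (simp add: d_def distrib_right sum.distrib if_distrib[of "\<lambda>x. x * _"] cong: if_cong)
      also have "\<dots> \<le> (\<Sum>j\<le>n. a j * ?q ^ j)"
        using \<delta> by (intro sum_mult_antimono_mono partial) (auto simp: mult_left_le_one_le)
      also have "\<dots> \<le> (\<Sum>p\<in>primes_upto (E n). - ln (1 - 1 / real p) * real p powr - \<delta>)"
        unfolding a_def E_def by (rule sum_euler_log_blocks_le[OF \<delta>])
      also have "\<dots> \<le> ln (1 + 1 / \<delta>) + 2 * \<delta>" by (rule sum_euler_log_powr_le[OF \<delta>])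
      finally show "(\<Sum>j\<le>n. ?q ^ j / real j) - C + (C + \<eta>) * ?q ^ k0 \<le> ln (1 + 1 / \<delta>) + 2 * \<delta>" .
    qed
  qed
  \<comment> \<open>As \<open>\<delta>\<close> tends to 0 the two logarithmic singularities cancel,
    and the limit is \<open>- C + (C + \<eta>) = \<eta>\<close>.\<close>
  have "((\<lambda>\<delta>::real. (- ln (1 - exp (- \<delta>)) - ln (1 + 1 / \<delta>)) - C + (C + \<eta>) * exp (- \<delta>) ^ k0 - 2 * \<delta>)
      \<longlongrightarrow> 0 - C + (C + \<eta>) * exp (- 0) ^ k0 - 2 * 0) (at_right 0)"
  proof (intro tendsto_diff tendsto_add tendsto_mult tendsto_power tendsto_exp tendsto_minus tendsto_const)
    show "((\<lambda>\<delta>::real. - ln (1 - exp (- \<delta>)) - ln (1 + 1 / \<delta>)) \<longlongrightarrow> 0) (at_right 0)"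
      by real_asymp
  qed (auto intro: tendsto_ident_at)
  then have "0 - C + (C + \<eta>) * exp (- 0) ^ k0 - 2 * 0 \<le> (0::real)"
  proof (rule tendsto_upperbound)
    show "eventually (\<lambda>\<delta>::real. (- ln (1 - exp (- \<delta>)) - ln (1 + 1 / \<delta>)) - C
        + (C + \<eta>) * exp (- \<delta>) ^ k0 - 2 * \<delta> \<le> 0) (at_right 0)"
      using eventually_at_right_less[of "0::real"] by eventually_elim (use main in \<open>simp add: algebra_simps\<close>)
  qed simp
  then show False using \<eta> by simp
qed

subsection \<open>Robin's inequality for \<open>t\<close>-free integers\<close>

lemma divisor_sigma_div_eq:
  assumes "m > 0"
  shows "real (divisor_sigma m) / real m = (\<Sum>d | d dvd m. 1 / real d)"
proof -
  have "real (divisor_sigma m) / real m = (\<Sum>d | d dvd m. real d / real m)"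
    by (simp add: divisor_sigma_def sum_divide_distrib)
  also have "\<dots> = (\<Sum>d | d dvd m. 1 / real d)"
    by (rule sum.reindex_bij_witness[of _ "\<lambda>d. m div d" "\<lambda>d. m div d"])
       (use assms in \<open>auto simp: real_of_nat_div\<close>)
  finally show ?thesis .
qed

text \<open>Every divisor of a \<open>t\<close>-free \<open>S\<close> has all multiplicities below
  \<open>t\<close>, so its reciprocal occurs in the Euler product truncated at
  \<open>t\<close>.\<close>

lemma divisor_sigma_le_prod:
  assumes "S > 0" "t_free t S"
  shows "real (divisor_sigma S) / real S \<le> (\<Prod>p\<in>prime_factors S. \<Sum>j<t. (1 / real p) ^ j)"
proof -
  define A where "A = {n. n > 0 \<and> prime_factors n \<subseteq> prime_factors S \<and> (\<forall>p\<in>prime_factors S. multiplicity p n < t)}"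
  have "finite A"
    unfolding A_def by (rule finite_euler_product(2)[of _ "\<lambda>n. 1 / real n"]) auto
  moreover have "{d. d dvd S} \<subseteq> A"
  proof
    fix d assume "d \<in> {d. d dvd S}"
    then have d: "d dvd S" by simp
    then have "d > 0" using assms by (auto intro!: Nat.gr0I)
    moreover have "prime_factors d \<subseteq> prime_factors S"
      using d assms by (intro dvd_prime_factors) auto
    moreover have "multiplicity p d < t" if "p \<in> prime_factors S" for p
    proof (rule ccontr)
      assume "\<not> multiplicity p d < t"
      then have "p ^ t dvd d" by (intro multiplicity_dvd') simp
      then show False using d assms(2) that by (auto simp: t_free_def dest: dvd_trans)
    qed
    ultimately show "d \<in> A" by (simp add: A_def)
  qed
  ultimately have "(\<Sum>d | d dvd S. 1 / real d) \<le> (\<Sum>d\<in>A. 1 / real d)"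
    by (intro sum_mono2) auto
  also have "\<dots> = (\<Prod>p\<in>prime_factors S. \<Sum>j<t. (1 / real p) ^ j)"
    unfolding A_def by (rule finite_euler_product(1)[symmetric]) auto
  finally show ?thesis by (simp add: divisor_sigma_div_eq[OF assms(1)])
qed

lemma geometric_prime_sum_le:
  assumes "prime (p :: nat)"
  shows "(\<Sum>j<t. (1 / real p) ^ j) = (1 - (1 / real p) ^ t) * exp (- ln (1 - 1 / real p))"
    and "(\<Sum>j<t. (1 / real p) ^ j) \<le> exp (- ln (1 - 1 / real p))"
    and "t \<ge> 1 \<Longrightarrow> 1 \<le> (\<Sum>j<t. (1 / real p) ^ j)"
proof -
  have p: "real p > 1" using prime_gt_1_nat[OF assms] by simp
  show eq: "(\<Sum>j<t. (1 / real p) ^ j) = (1 - (1 / real p) ^ t) * exp (- ln (1 - 1 / real p))"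
    using p by (subst sum_gp_strict) (auto simp: exp_minus divide_inverse[of "1 - _"])
  show "(\<Sum>j<t. (1 / real p) ^ j) \<le> exp (- ln (1 - 1 / real p))"
    unfolding eq using p by (intro mult_left_le_one_le) (auto simp: power_le_one)
  show "1 \<le> (\<Sum>j<t. (1 / real p) ^ j)" if "t \<ge> 1"
    using member_le_sum[of 0 "{..<t}" "\<lambda>j. (1 / real p) ^ j"] that by auto
qed

text \<open>With \<open>y = ln S\<close>, the product of these primes divides \<open>S\<close>, so
  there are at most \<open>y / ln y\<close> of them. Each contributes at most
  \<open>1 / (y - 1)\<close>, and \<open>y / (y - 1) \<le> 2\<close>.\<close>

lemma large_prime_factors_sum_le:
  assumes "S > 0" "ln (real S) \<ge> 2"
  shows "(\<Sum>p | p \<in> prime_factors S \<and> real p > ln (real S). - ln (1 - 1 / real p)) \<le> 2 / ln (ln (real S))"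
proof -
  define y where "y = ln (real S)"
  define Q where "Q = {p \<in> prime_factors S. real p > y}"
  have "y \<ge> 2" using assms by (simp add: y_def)
  then have y: "y \<ge> 2" "ln y > 0" by simp_all
  have Q: "finite Q" "\<And>p. p \<in> Q \<Longrightarrow> prime p" "\<And>p. p \<in> Q \<Longrightarrow> p dvd S" "\<And>p. p \<in> Q \<Longrightarrow> real p > y"
    by (auto simp: Q_def prime_factors_dvd)
  have "\<Prod>Q dvd S" using Q by (intro prod_primes_dvd) auto
  then have "\<Prod>Q \<le> S" by (rule dvd_imp_le) (rule assms)
  then have "real (\<Prod>Q) \<le> real S" by (simp only: of_nat_le_iff)
  moreover have "real (\<Prod>Q) > 0" unfolding of_nat_prod using Q(2) prime_gt_0_nat by (intro prod_pos) auto
  ultimately have "ln (real (\<Prod>Q)) \<le> y" unfolding y_def using assms by (subst ln_le_cancel_iff) auto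
  moreover have "ln (real (\<Prod>Q)) = (\<Sum>p\<in>Q. ln (real p))"
    using Q(1,2) prime_gt_0_nat unfolding of_nat_prod by (subst ln_prod) force+
  moreover have "(\<Sum>p\<in>Q. ln y) \<le> (\<Sum>p\<in>Q. ln (real p))"
    using Q y by (intro sum_mono ln_mono) (auto simp: less_imp_le)
  ultimately have "real (card Q) * ln y \<le> y" by simp
  then have card: "real (card Q) \<le> y / ln y" using y by (simp add: field_simps)
  have "(\<Sum>p\<in>Q. - ln (1 - 1 / real p)) \<le> (\<Sum>p\<in>Q. 1 / (y - 1))"
  proof (rule sum_mono)
    fix p assume p: "p \<in> Q"
    have "- ln (1 - 1 / real p) \<le> 1 / (real p - 1)" by (rule euler_factor_bounds(2)[OF Q(2)[OF p]])
    also have "\<dots> \<le> 1 / (y - 1)" using Q(4)[OF p] y by (intro frac_le) auto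
    finally show "- ln (1 - 1 / real p) \<le> 1 / (y - 1)" .
  qed
  also have "\<dots> = real (card Q) * (1 / (y - 1))" by simp
  also have "\<dots> \<le> y / ln y * (1 / (y - 1))" using card y by (intro mult_right_mono) auto
  also have "\<dots> = y / (y - 1) * (1 / ln y)" by simp
  also have "\<dots> \<le> 2 * (1 / ln y)" using y by (intro mult_right_mono) (auto simp: field_simps)
  finally show ?thesis by (simp add: Q_def y_def)
qed

lemma prod_prime_factors_le:
  assumes "S > 0" "ln (real S) \<ge> 2" "t \<ge> 1"
  shows "(\<Prod>p\<in>prime_factors S. \<Sum>j<t. (1 / real p) ^ j) \<le>
    (1 - (1 / 2) ^ t) * exp (euler_log (nat \<lfloor>ln (real S)\<rfloor>) + 2 / ln (ln (real S)))"
proof -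
  define h where "h p = (\<Sum>j<t. (1 / real p) ^ j)" for p :: nat
  let ?g = "\<lambda>p::nat. - ln (1 - 1 / real p)"
  define y where "y = ln (real S)"
  define n where "n = nat \<lfloor>y\<rfloor>"
  define P where "P = {p \<in> prime_factors S. real p \<le> y}"
  define Q where "Q = {p \<in> prime_factors S. real p > y}"
  have y: "y \<ge> 2" using assms by (simp add: y_def)
  have n2: "n \<ge> 2" using y by (simp add: n_def le_nat_iff le_floor_iff)
  have split: "prime_factors S = P \<union> Q" "P \<inter> Q = {}" "finite P" "finite Q" by (auto simp: P_def Q_def)
  have Q: "prime p" if "p \<in> Q" for p using that by (auto simp: Q_def)
  have P: "P \<subseteq> primes_upto n"
    using y by (auto simp: P_def primes_upto_def n_def le_nat_iff le_floor_iff)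
  have pr: "prime p" if "p \<in> primes_upto n" for p using that by (simp add: primes_upto_def)
  have h1: "1 \<le> h p" if "prime p" for p using geometric_prime_sum_le(3)[OF that assms(3)] by (simp add: h_def)
  have h0: "0 \<le> h p" for p by (simp add: h_def sum_nonneg)
  have hg: "h p \<le> exp (?g p)" if "prime p" for p using geometric_prime_sum_le(2)[OF that] by (simp add: h_def)
  have two: "2 \<in> primes_upto n" using n2 by (simp add: primes_upto_def)
  \<comment> \<open>All factors are at least 1, so the product may be extended to every prime up to
    \<open>n\<close>. This brings in the prime 2 even when \<open>S\<close> is odd, and only its
    saving is kept.\<close>
  have "prod h P \<le> prod h (primes_upto n)"
    using P h1 h0 pr by (intro prod_mono2) auto
  also have "\<dots> = h 2 * prod h (primes_upto n - {2})" using two by (simp add: prod.remove)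
  also have "\<dots> \<le> h 2 * (\<Prod>p\<in>primes_upto n - {2}. exp (?g p))"
    using pr h0 hg by (intro mult_left_mono prod_mono) auto
  also have "h 2 = (1 - (1 / 2) ^ t) * exp (?g 2)"
    using geometric_prime_sum_le(1)[of 2 t] by (simp add: h_def)
  also have "(1 - (1 / 2) ^ t) * exp (?g 2) * (\<Prod>p\<in>primes_upto n - {2}. exp (?g p)) =
      (1 - (1 / 2) ^ t) * (\<Prod>p\<in>primes_upto n. exp (?g p))"
    using two by (simp add: prod.remove)
  also have "(\<Prod>p\<in>primes_upto n. exp (?g p)) = exp (euler_log n)"
    by (simp add: euler_log_def exp_sum)
  finally have boundP: "prod h P \<le> (1 - (1 / 2) ^ t) * exp (euler_log n)" .
  have "prod h Q \<le> (\<Prod>p\<in>Q. exp (?g p))"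
    using Q h0 hg by (intro prod_mono) auto
  also have "\<dots> = exp (\<Sum>p\<in>Q. ?g p)" using split by (simp add: exp_sum)
  also have "\<dots> \<le> exp (2 / ln y)"
    using large_prime_factors_sum_le[OF assms(1,2)] by (simp add: Q_def y_def)
  finally have boundQ: "prod h Q \<le> exp (2 / ln y)" .
  have "prod h (prime_factors S) = prod h P * prod h Q"
    unfolding split(1) using split by (intro prod.union_disjoint) auto
  also have "\<dots> \<le> ((1 - (1 / 2) ^ t) * exp (euler_log n)) * exp (2 / ln y)"
    using boundP boundQ Q h0 by (intro mult_mono) (auto intro!: prod_nonneg simp: power_le_one)
  finally show ?thesis by (simp add: h_def y_def n_def exp_add)
qed

text \<open>The constant 20 is 18 from Mertens' third theorem plus 2 from the large primes. As
  \<open>1 - 2 ^ (-t) \<le> exp (- 2 ^ (-t))\<close>, the saving wins once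
  \<open>20 / ln y < 2 ^ (-t)\<close>.\<close>

theorem robin_inequality_t_free:
  assumes "S > 0" "t_free t S" "t \<ge> 1" "ln (real S) \<ge> 3" "20 * 2 ^ t < ln (ln (real S))"
  shows "real (divisor_sigma S) < exp euler_mascheroni * real S * ln (ln (real S))"
proof -
  define y where "y = ln (real S)"
  define n where "n = nat \<lfloor>y\<rfloor>"
  have "y \<ge> 3" using assms by (simp add: y_def)
  then have y: "y \<ge> 3" "ln y > 0" by simp_all
  have n: "n \<ge> 2" "real n \<le> y" "real n \<ge> y - 1"
    using y by (simp_all add: n_def le_nat_iff le_floor_iff)
  \<comment> \<open>This gives \<open>ln n \<ge> ln y / 2\<close>, so passing from \<open>n\<close>
    back to \<open>y\<close> turns the error \<open>9 / ln n\<close> into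
    \<open>18 / ln y\<close>.\<close>
  have "y \<le> real n ^ 2"
  proof -
    have "0 \<le> (y - 3) * y + 1" using y by (intro add_nonneg_nonneg mult_nonneg_nonneg) auto
    then have "y \<le> (y - 1) ^ 2" by (simp add: power2_eq_square algebra_simps)
    also have "\<dots> \<le> real n ^ 2" using n y by (intro power_mono) auto
    finally show ?thesis .
  qed
  then have "ln y \<le> ln (real n ^ 2)" using y by (intro ln_mono) auto
  then have lnn: "ln y \<le> 2 * ln (real n)" using n by (simp add: ln_realpow)
  have "9 / ln (real n) \<le> 9 / (ln y / 2)" using lnn y by (intro divide_left_mono mult_pos_pos) linarith+
  moreover have "ln (ln (real n)) \<le> ln (ln y)" using n y by (intro ln_mono) auto
  ultimately have "euler_log n \<le> ln (ln y) + euler_mascheroni + 18 / ln y"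
    using mertens_third_upper[OF n(1)] by simp
  then have e: "euler_log n + 2 / ln y \<le> ln (ln y) + euler_mascheroni + 20 / ln y"
    by (simp add: add_divide_distrib[symmetric])
  have z: "20 / ln y < (1 / 2) ^ t"
    using assms(5) y by (simp add: y_def field_simps power_divide)
  have "real (divisor_sigma S) / real S \<le> (1 - (1 / 2) ^ t) * exp (euler_log n + 2 / ln y)"
    using divisor_sigma_le_prod[OF assms(1,2)] prod_prime_factors_le[OF assms(1) _ assms(3)] assms(4)
    by (simp add: n_def y_def)
  also have "\<dots> \<le> exp (- ((1 / 2) ^ t)) * exp (ln (ln y) + euler_mascheroni + 20 / ln y)"
    using e exp_ge_add_one_self[of "- ((1 / 2) ^ t)"] by (intro mult_mono) auto
  also have "\<dots> = exp (ln (ln y) + euler_mascheroni + (20 / ln y - (1 / 2) ^ t))"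
    by (simp add: exp_add[symmetric])
  also have "\<dots> < exp (ln (ln y) + euler_mascheroni)" using z by simp
  also have "\<dots> = exp euler_mascheroni * ln y" using y by (simp add: exp_add)
  finally show ?thesis using assms(1) by (simp add: y_def field_simps)
qed

text \<open>A crude bound suffices: it yields \<open>ln S \<ge> n * ln 2\<close> for
  \<open>S \<ge> primorial n\<close>.\<close>

lemma primorial_ge: "2 ^ n \<le> primorial n"
proof -
  have "2 \<le> nth_prime1 i" for i
    using enumerate_in_set[OF primes_infinite, of "i - 1"] prime_ge_2_nat
    by (simp add: nth_prime1_def)
  then have "(\<Prod>i\<in>{1..n}. 2) \<le> primorial n" unfolding primorial_def by (intro prod_mono) auto
  then show ?thesis by simp
qed

theorem mainTheorem12:
  fixes t :: "nat \<Rightarrow> int" and S :: "nat \<Rightarrow> nat"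
  assumes t_ge: "\<And>n. t n \<ge> 2"
    and t_small: "(\<lambda>n. real_of_int (t n)) \<in> o(\<lambda>n. ln (ln (real n)))"
    and S_pos: "\<And>n. S n > 0"
    and S_prop: "eventually (\<lambda>n. S n \<ge> primorial n \<and> t_free (nat (t n)) (S n)) sequentially"
  shows "eventually (\<lambda>n. real (divisor_sigma (S n))
           < exp euler_mascheroni * real (S n) * ln (ln (real (S n)))) sequentially"
proof -
  have "eventually (\<lambda>n. norm (real_of_int (t n)) \<le> 1 / 2 * norm (ln (ln (real n)))) sequentially"
    using t_small by (rule landau_o.smallD) simp
  moreover have "eventually (\<lambda>n. ln (ln (real n)) > 0) sequentially" by real_asymp
  moreover have "eventually (\<lambda>n. ln (real n) > 0) sequentially" by real_asymp
  moreover have "eventually (\<lambda>n. real n * ln 2 \<ge> 3) sequentially" by real_asymp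
  \<comment> \<open>With the constant \<open>1 / 2\<close> above, \<open>2 ^ t \<le> exp t\<close>
    is at most the square root of \<open>ln n\<close>, which is of smaller order than
    \<open>ln (n * ln 2)\<close>.\<close>
  moreover have "eventually (\<lambda>n. 20 * exp (1 / 2 * ln (ln (real n))) < ln (real n * ln 2)) sequentially"
    by real_asymp
  ultimately show ?thesis using S_prop
  proof eventually_elim
    case (elim n)
    have "2 ^ n \<le> S n" using primorial_ge[of n] elim by linarith
    then have "real (2 ^ n) \<le> real (S n)" by (simp only: of_nat_le_iff)
    then have "ln (2 ^ n) \<le> ln (real (S n))" by (intro ln_mono) auto
    then have y: "real n * ln 2 \<le> ln (real (S n))" by (simp add: ln_realpow)
    have "(2::real) ^ nat (t n) = exp (real (nat (t n)) * ln 2)" by (simp add: exp_of_nat_mult)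
    also have "\<dots> \<le> exp (real_of_int (t n))"
      using t_ge[of n] ln_le_minus_one[of "2::real"] by (simp add: mult_left_le)
    also have "\<dots> \<le> exp (1 / 2 * ln (ln (real n)))" using elim t_ge[of n] by simp
    finally have "20 * 2 ^ nat (t n) < ln (real n * ln 2)" using elim by linarith
    also have "\<dots> \<le> ln (ln (real (S n)))" using y elim by (intro ln_mono) auto
    finally show ?case
      using S_pos[of n] t_ge[of n] elim y by (intro robin_inequality_t_free[of _ "nat (t n)"]) auto
  qed
qed

end
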